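(* Let $t_0\in\mathbb{R}$, $n\ge 1$. Let $p,q,f,r_1,\dots,r_n$ be real-valued locally integrable functions on $[t_0,+\infty)$ with $p(t)>0$, let $\alpha_1,\dots,\alpha_n$ be real-valued locally measurable functions on $[t_0,+\infty)$ with $\alpha_j(t)\le t$ for all $t\ge t_0$, and let $r_{1,1},\dots,r_{1,n}$ be real-valued continuous functions on $[t_0,+\infty)$. Consider the equations $$(p(t)\phi'(t))'+q(t)\phi'(t)+\sum_{j=1}^n r_j(t)\phi(\alpha_j(t))=f(t),\quad t\ge t_0,\qquad (A)$$ $$(p(t)\phi'(t))'+q(t)\phi'(t)+\sum_{j=1}^n r_{1,j}(t)\phi(\alpha_j(t))=0,\quad t\ge t_0.\qquad (B)$$ Suppose that: (I) $r_j(t)\ge r_{1,j}(t)$ for all $t\ge t_0$, $j=1,\dots,n$; (II) for every $t\ge t_0$ and every $j=1,\dots,n$: if $r_{1,j}(t)<0$, then $r_j(t)\ge 0$ or $\alpha_j(t)=t$; (III) $\lim_{t\to+\infty}\alpha_j(t)=+\infty$ for $j=1,\dots,n$; and that for every $T\ge t_0$ there exist $T<s_1<t_1\le s_2<t_2$ such that (IV) $f(t)\le 0$ for $t\in[s_1,t_1]$ and $f(t)\ge 0$ for $t\in[s_2,t_2]$; (V) equation (B) is oscillatory on each of the intervals $[s_1,t_1]$ and $[s_2,t_2]$. Then equation (A) is oscillatory.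
   Context: Interpretation of the equations. An equation $(p\phi')'+q\phi'+\sum_{j=1}^n\rho_j(t)\phi(\alpha_j(t))=g(t)$, $t\ge t_0$, is understood in the sense of its equivalence, via $\psi=p\phi'$, to the system $$\phi'(t)=\frac{1}{p(t)}\psi(t),\qquad \psi'(t)=-\sum_{j=1}^n\rho_j(t)\phi(\alpha_j(t))-\frac{q(t)}{p(t)}\psi(t)+g(t),\quad t\ge t_0 .$$ A solution with initial point $\tau_0\ge t_0$ is a continuous function $\phi:\mathbb{R}\to\mathbb{R}$ such that on $[\tau_0,+\infty)$ there is a locally absolutely continuous $\psi$ (denoted $p\phi'$) with $\phi$ locally absolutely continuous and the system satisfied almost everywhere on $[\tau_0,+\infty)$; on $(-\infty,\tau_0]$, $\phi$ is an arbitrary continuous function (the initial function). A solution of the equation means a solution with some initial point $\tau_0\ge t_0$. Standing assumptions: $1/p$ and $q/p$ are locally integrable on $[t_0,+\infty)$, and for each of the equations considered, every $\tau_0\ge t_0$, every continuous $\theta:(-\infty,\tau_0]\to\mathbb{R}$ and every $\zeta\in\mathbb{R}$, there is exactly one solution with initial point $\tau_0$, $\phi=\theta$ on $(-\infty,\tau_0]$ and $\psi(\tau_0)=p(\tau_0)\zeta$ (i.e. $\phi'(\tau_0)=\zeta$). A solution is called oscillatory if it has arbitrarily large zeros. An equation is called oscillatory if all its solutions are oscillatory. An equation is called oscillatory on an interval $[a,b]\subset[t_0,+\infty)$ if every solution of it with initial point $\tau_0\le a$ (so that the equation holds on $[a,b]$) vanishes at some point of $[a,b]$. *)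

theory Defs
  imports "HOL-Analysis.Analysis"
begin

text \<open>Absolute continuity of \<open>f\<close> on the interval \<open>[a, b]\<close>: a finite family of
  non-overlapping closed subintervals \<open>K = [Inf K, Sup K]\<close> of \<open>[a, b]\<close> is a division
  of its own union.\<close>

definition absolutely_continuous_on :: "real \<Rightarrow> real \<Rightarrow> (real \<Rightarrow> real) \<Rightarrow> bool" where
  "absolutely_continuous_on a b f \<longleftrightarrow>
    (\<forall>\<epsilon>>0. \<exists>\<delta>>0. \<forall>\<D>. \<D> division_of \<Union>\<D> \<and> \<Union>\<D> \<subseteq> {a..b} \<and> (\<Sum>K\<in>\<D>. Sup K - Inf K) < \<delta>
       \<longrightarrow> (\<Sum>K\<in>\<D>. \<bar>f (Sup K) - f (Inf K)\<bar>) < \<epsilon>)"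

definition locally_absolutely_continuous_from :: "real \<Rightarrow> (real \<Rightarrow> real) \<Rightarrow> bool" where
  "locally_absolutely_continuous_from c f \<longleftrightarrow>
    (\<forall>a b. c \<le> a \<and> a \<le> b \<longrightarrow> absolutely_continuous_on a b f)"

definition locally_integrable_from :: "real \<Rightarrow> (real \<Rightarrow> real) \<Rightarrow> bool" where
  "locally_integrable_from c f \<longleftrightarrow>
    (\<forall>a b. c \<le> a \<and> a \<le> b \<longrightarrow> f absolutely_integrable_on {a..b})"

definition locally_measurable_from :: "real \<Rightarrow> (real \<Rightarrow> real) \<Rightarrow> bool" where
  "locally_measurable_from c f \<longleftrightarrow>
    (\<forall>a b. c \<le> a \<and> a \<le> b \<longrightarrow> f \<in> borel_measurable (lebesgue_on {a..b}))"

text \<open>All predicates below refer to the equation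
  \[ (p \phi')' + q \phi' + \sum_{j=1}^n \rho_j(t)\, \phi(\alpha_j(t)) = g(t), \qquad t \ge t_0, \]
  given by the data \<open>p q n \<rho> \<alpha> g\<close> (and \<open>t0\<close> where relevant), understood as a first-order
  system for \<open>(\<phi>, \<psi>)\<close> with \<open>\<psi> = p \<phi>'\<close>.  In a solution pair with initial point \<open>\<tau>\<close>,
  only the values of \<open>\<psi>\<close> on \<open>[\<tau>, \<infinity>)\<close> matter.\<close>

definition solution_pair ::
  "(real \<Rightarrow> real) \<Rightarrow> (real \<Rightarrow> real) \<Rightarrow> nat \<Rightarrow> (nat \<Rightarrow> real \<Rightarrow> real) \<Rightarrow> (nat \<Rightarrow> real \<Rightarrow> real) \<Rightarrow>
   (real \<Rightarrow> real) \<Rightarrow> real \<Rightarrow> (real \<Rightarrow> real) \<Rightarrow> (real \<Rightarrow> real) \<Rightarrow> bool" where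
  "solution_pair p q n \<rho> \<alpha> g \<tau> \<phi> \<psi> \<longleftrightarrow>
     continuous_on UNIV \<phi> \<and>
     locally_absolutely_continuous_from \<tau> \<phi> \<and>
     locally_absolutely_continuous_from \<tau> \<psi> \<and>
     (AE t\<in>{\<tau>..} in lebesgue.
        (\<phi> has_real_derivative 1 / p t * \<psi> t) (at t within {\<tau>..}) \<and>
        (\<psi> has_real_derivative
           - (\<Sum>j=1..n. \<rho> j t * \<phi> (\<alpha> j t)) - q t / p t * \<psi> t + g t) (at t within {\<tau>..}))"

definition solution_from ::
  "(real \<Rightarrow> real) \<Rightarrow> (real \<Rightarrow> real) \<Rightarrow> nat \<Rightarrow> (nat \<Rightarrow> real \<Rightarrow> real) \<Rightarrow> (nat \<Rightarrow> real \<Rightarrow> real) \<Rightarrow>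
   (real \<Rightarrow> real) \<Rightarrow> real \<Rightarrow> (real \<Rightarrow> real) \<Rightarrow> bool" where
  "solution_from p q n \<rho> \<alpha> g \<tau> \<phi> \<longleftrightarrow> (\<exists>\<psi>. solution_pair p q n \<rho> \<alpha> g \<tau> \<phi> \<psi>)"

definition uniquely_solvable ::
  "real \<Rightarrow> (real \<Rightarrow> real) \<Rightarrow> (real \<Rightarrow> real) \<Rightarrow> nat \<Rightarrow> (nat \<Rightarrow> real \<Rightarrow> real) \<Rightarrow>
   (nat \<Rightarrow> real \<Rightarrow> real) \<Rightarrow> (real \<Rightarrow> real) \<Rightarrow> bool" where
  "uniquely_solvable t0 p q n \<rho> \<alpha> g \<longleftrightarrow>
     (\<forall>\<tau>\<ge>t0. \<forall>\<theta> \<zeta>. continuous_on {..\<tau>} \<theta> \<longrightarrow>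
        (\<exists>!\<phi>. (\<forall>t\<le>\<tau>. \<phi> t = \<theta> t) \<and>
           (\<exists>\<psi>. solution_pair p q n \<rho> \<alpha> g \<tau> \<phi> \<psi> \<and> \<psi> \<tau> = p \<tau> * \<zeta>)))"

definition oscillatory_function :: "(real \<Rightarrow> real) \<Rightarrow> bool" where
  "oscillatory_function \<phi> \<longleftrightarrow> (\<forall>T. \<exists>t>T. \<phi> t = 0)"

definition oscillatory ::
  "real \<Rightarrow> (real \<Rightarrow> real) \<Rightarrow> (real \<Rightarrow> real) \<Rightarrow> nat \<Rightarrow> (nat \<Rightarrow> real \<Rightarrow> real) \<Rightarrow>
   (nat \<Rightarrow> real \<Rightarrow> real) \<Rightarrow> (real \<Rightarrow> real) \<Rightarrow> bool" where
  "oscillatory t0 p q n \<rho> \<alpha> g \<longleftrightarrow>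
     (\<forall>\<tau>\<ge>t0. \<forall>\<phi>. solution_from p q n \<rho> \<alpha> g \<tau> \<phi> \<longrightarrow> oscillatory_function \<phi>)"

definition oscillatory_on ::
  "real \<Rightarrow> (real \<Rightarrow> real) \<Rightarrow> (real \<Rightarrow> real) \<Rightarrow> nat \<Rightarrow> (nat \<Rightarrow> real \<Rightarrow> real) \<Rightarrow>
   (nat \<Rightarrow> real \<Rightarrow> real) \<Rightarrow> (real \<Rightarrow> real) \<Rightarrow> real \<Rightarrow> real \<Rightarrow> bool" where
  "oscillatory_on t0 p q n \<rho> \<alpha> g a b \<longleftrightarrow>
     (\<forall>\<tau> \<phi>. t0 \<le> \<tau> \<and> \<tau> \<le> a \<and> solution_from p q n \<rho> \<alpha> g \<tau> \<phi> \<longrightarrow> (\<exists>t\<in>{a..b}. \<phi> t = 0))"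

end

theory Submission
  imports Defs
begin

text \<open>
  Suppose a solution \<open>\<phi>\<close> of the forced equation with coefficients \<open>r\<close> has no zeros from some
  point on. Replacing \<open>\<phi>\<close> and \<open>f\<close> by their negatives if necessary, \<open>\<phi>\<close> is eventually positive, and
  far enough to the right there is an interval \<open>[s, e]\<close> on which \<open>f \<le> 0\<close>, on which all delayed
  values \<open>\<phi> (\<alpha> j t)\<close> are positive too, and on which the unforced equation with coefficients \<open>r1\<close> is
  oscillatory. The contradiction comes from a solution \<open>\<omega>\<close> of the unforced equation that is
  positive on \<open>[s, e]\<close>: it has \<open>\<phi>\<close> itself as initial function on \<open>(-\<infinity>, s]\<close>, and a slope at \<open>s\<close>
  slightly larger than that of \<open>\<phi>\<close>.

  To see that \<open>\<omega>\<close> stays above \<open>\<phi>\<close>, let \<open>\<psi> = p \<phi>'\<close> and \<open>\<Omega> = p \<omega>'\<close> and consider the weighted Wronskian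
  \<open>W = \<phi> \<Omega> - \<omega> \<psi>\<close>. It is positive at \<open>s\<close>, and \<open>(\<omega> / \<phi>)' = W / (p \<phi>\<^sup>2)\<close>, so the ratio \<open>\<omega> / \<phi>\<close> increases
  from its initial value 1 as long as \<open>W\<close> is positive. The two equations give
  \<open>W' + (q / p) W = (\<Sum>j. r j t \<phi> (\<alpha> j t) \<omega> t - r1 j t \<omega> (\<alpha> j t) \<phi> t) - f \<omega>\<close>,
  and as long as the ratio increases, its value at the earlier time \<open>\<alpha> j t\<close> is at most its value at
  \<open>t\<close>, which together with the sign conditions on \<open>r\<close> and \<open>r1\<close> makes every summand nonnegative
  (lemma \<open>coefficient_comparison\<close>). Hence \<open>W' \<ge> - (q / p) W\<close>, so \<open>W\<close> is bounded below by a positive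
  constant up to a hypothetical first zero, which therefore cannot exist. This bootstrap is
  lemma \<open>solution_comparison\<close>.

  The derivatives exist only almost everywhere, so each step from a differential inequality to an
  inequality between values rests on absolute continuity, through lemma \<open>integral_le_increment\<close>.
\<close>

section \<open>Absolutely continuous functions with derivative bounded below\<close>

text \<open>
  In a tagged partial division one and the same degenerate interval may carry several tags.
  Degenerate intervals add nothing to either sum, so the estimate for divisions carries over to
  tagged ones.
\<close>

lemma absolutely_continuous_on_tagged:
  assumes F: "absolutely_continuous_on a b F" and e: "0 < e"
  obtains d where "0 < d"
    "\<And>q. q tagged_partial_division_of {a..b} \<Longrightarrow> measure lebesgue (\<Union>(snd ` q)) < d
      \<Longrightarrow> (\<Sum>(x,K)\<in>q. \<bar>F (Sup K) - F (Inf K)\<bar>) < e"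
proof -
  from F e obtain d where "0 < d" and
    d: "\<And>D. D division_of \<Union>D \<Longrightarrow> \<Union>D \<subseteq> {a..b} \<Longrightarrow> (\<Sum>K\<in>D. Sup K - Inf K) < d
        \<Longrightarrow> (\<Sum>K\<in>D. \<bar>F (Sup K) - F (Inf K)\<bar>) < e"
    unfolding absolutely_continuous_on_def by meson
  have "(\<Sum>(x,K)\<in>q. \<bar>F (Sup K) - F (Inf K)\<bar>) < e"
    if q: "q tagged_partial_division_of {a..b}" and small: "measure lebesgue (\<Union>(snd ` q)) < d" for q
  proof -
    let ?D = "snd ` q"
    have D: "?D division_of \<Union>?D"
      by (rule partial_division_of_tagged_division[OF q])
    have len: "measure lebesgue K = Sup K - Inf K" if K: "K \<in> ?D" for K
    proof -
      obtain u v where "K = cbox u v" "K \<noteq> {}"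
        using division_ofD(3,4)[OF D K] by auto
      then show ?thesis by auto
    qed
    have "(\<Sum>K\<in>?D. Sup K - Inf K) = (\<Sum>K\<in>?D. measure lebesgue K)"
      using len by (intro sum.cong) auto
    also have "\<dots> = measure lebesgue (\<Union>?D)"
      using content_division[OF D] by simp
    finally have "(\<Sum>K\<in>?D. Sup K - Inf K) < d" using small by simp
    moreover have "\<Union>?D \<subseteq> {a..b}"
      using tagged_partial_division_ofD(3)[OF q] by fastforce
    ultimately have less: "(\<Sum>K\<in>?D. \<bar>F (Sup K) - F (Inf K)\<bar>) < e"
      using d[OF D] by blast
    let ?d = "\<lambda>K::real set. if K = {} then 0 else \<bar>F (Sup K) - F (Inf K)\<bar>"
    have ne: "K \<noteq> {}" if "K \<in> ?D" for K using division_ofD(3)[OF D that] .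
    have "(\<Sum>(x,K)\<in>q. \<bar>F (Sup K) - F (Inf K)\<bar>) = (\<Sum>(x,K)\<in>q. ?d K)"
      using ne by (intro sum.cong) force+
    also have "\<dots> = (\<Sum>K\<in>?D. ?d K)"
    proof (rule sum.over_tagged_division_lemma[OF tagged_partial_division_of_Union_self[OF q]])
      fix u v :: real assume "box u v = {}"
      then have "v \<le> u" by (simp add: box_eq_empty)
      then show "?d (cbox u v) = 0" by (cases "u = v") auto
    qed
    also have "\<dots> = (\<Sum>K\<in>?D. \<bar>F (Sup K) - F (Inf K)\<bar>)"
      using ne by (intro sum.cong) auto
    finally show ?thesis using less by simp
  qed
  with \<open>0 < d\<close> show ?thesis by (rule that)
qed

text \<open>
  A one-sided straddle estimate: the interval surrounds \<open>x\<close>, so the errors of the linear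
  approximation at its two ends add up to at most \<open>e\<close> times its length.
\<close>

lemma derivative_straddle:
  assumes "(F has_real_derivative D) (at x within S)" "g \<le> D" "0 < e"
  obtains d where "0 < d"
    "\<And>u v. u \<le> x \<Longrightarrow> x \<le> v \<Longrightarrow> {u..v} \<subseteq> S \<Longrightarrow> {u..v} \<subseteq> ball x d \<Longrightarrow> (g - e) * (v - u) \<le> F v - F u"
proof -
  from assms(1) have "(F has_derivative (\<lambda>h. D * h)) (at x within S)"
    by (simp add: has_field_derivative_def)
  then obtain d where "0 < d" and
    d: "\<And>y. y \<in> S \<Longrightarrow> \<bar>y - x\<bar> < d \<Longrightarrow> \<bar>F y - F x - D * (y - x)\<bar> \<le> e * \<bar>y - x\<bar>"
    using \<open>0 < e\<close> unfolding has_derivative_within_alt by (auto simp: real_norm_def)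
  have "(g - e) * (v - u) \<le> F v - F u"
    if "u \<le> x" "x \<le> v" "{u..v} \<subseteq> S" "{u..v} \<subseteq> ball x d" for u v
  proof -
    have "u \<in> {u..v}" "v \<in> {u..v}" using that by auto
    then have "u \<in> S" "v \<in> S" "u \<in> ball x d" "v \<in> ball x d"
      using that by blast+
    then have "u \<in> S" "v \<in> S" "\<bar>u - x\<bar> < d" "\<bar>v - x\<bar> < d"
      by (simp_all add: dist_real_def abs_minus_commute)
    then have "\<bar>F v - F x - D * (v - x)\<bar> \<le> e * (v - x)" "\<bar>F u - F x - D * (u - x)\<bar> \<le> e * (x - u)"
      using d[of v] d[of u] that by auto
    then have "(D - e) * (v - u) \<le> F v - F u" by (simp add: algebra_simps abs_le_iff)
    moreover have "(g - e) * (v - u) \<le> (D - e) * (v - u)"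
      using that assms by (intro mult_right_mono) auto
    ultimately show ?thesis by linarith
  qed
  with \<open>0 < d\<close> show ?thesis by (rule that)
qed

text \<open>
  Half of the fundamental theorem of calculus for absolutely continuous functions, proved by a gauge.
  At a point outside the exceptional null set \<open>N\<close>, the gauge enforces the straddle estimate. At a
  point of \<open>N\<close>, it confines the interval to an open set of small measure, so that absolute
  continuity makes the total increment over these intervals small. Comparing the increment of \<open>F\<close>
  with a Riemann sum of \<open>g\<close> then costs only multiples of \<open>e\<close>.
\<close>

lemma integral_le_increment:
  fixes F g :: "real \<Rightarrow> real"
  assumes F: "absolutely_continuous_on a b F" and "a \<le> b"
    and g: "g integrable_on {a..b}"
    and ae: "AE x in lebesgue. x \<in> {a..b} \<longrightarrow>
      (\<exists>D\<ge>g x. (F has_real_derivative D) (at x within {a..b}))"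
  shows "integral {a..b} g \<le> F b - F a"
proof (rule field_le_epsilon)
  fix e0 :: real assume "0 < e0"
  define e where "e = e0 / (b - a + 2)"
  have "0 < e" and e0: "e * (b - a + 2) = e0"
    using \<open>0 < e0\<close> \<open>a \<le> b\<close> by (simp_all add: e_def)
  obtain N where N: "negligible N"
    and deriv: "\<And>x. x \<in> {a..b} \<Longrightarrow> x \<notin> N \<Longrightarrow> \<exists>D\<ge>g x. (F has_real_derivative D) (at x within {a..b})"
    using ae unfolding eventually_ae_filter_negligible by blast
  obtain d where "0 < d" and d: "\<And>q. q tagged_partial_division_of {a..b} \<Longrightarrow>
      measure lebesgue (\<Union>(snd ` q)) < d \<Longrightarrow> (\<Sum>(x,K)\<in>q. \<bar>F (Sup K) - F (Inf K)\<bar>) < e"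
    using absolutely_continuous_on_tagged[OF F \<open>0 < e\<close>] by blast
  have "N \<in> sets lebesgue"
    using N by (simp add: negligible_imp_sets)
  then obtain U where U: "open U" "N \<subseteq> U" "(U - N) \<in> lmeasurable" "emeasure lebesgue (U - N) < ennreal d"
    using sets_lebesgue_outer_open \<open>0 < d\<close> by metis
  have "U = (U - N) \<union> N" using U(2) by blast
  then have Um: "U \<in> lmeasurable" "measure lebesgue U < d"
  proof -
    have *: "emeasure lebesgue U = emeasure lebesgue (U - N)"
      using N \<open>open U\<close> by (simp add: emeasure_Diff_null_set negligible_iff_null_sets)
    show "U \<in> lmeasurable"
      using \<open>U = (U - N) \<union> N\<close> U(3) N by (metis fmeasurable.Un negligible_imp_measurable)
    then show "measure lebesgue U < d"
      using * U(4) \<open>0 < d\<close> by (metis emeasure_eq_measure2 ennreal_less_iff measure_nonneg)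
  qed
  \<comment> \<open>Setting \<open>g\<close> to 0 on \<open>N\<close> leaves the integral unchanged and removes the tags in \<open>N\<close>, where
    nothing is known about \<open>g\<close>, from the Riemann sums.\<close>
  define g0 where "g0 x = (if x \<in> N then 0 else g x)" for x
  have "(g0 has_integral integral {a..b} g) {a..b}"
    by (rule has_integral_spike[OF N _ integrable_integral[OF g]]) (simp add: g0_def)
  then have g0: "(g0 has_integral integral {a..b} g) (cbox a b)" by simp
  obtain G where "gauge G" and
    G: "\<And>p. p tagged_division_of (cbox a b) \<Longrightarrow> G fine p \<Longrightarrow>
      norm ((\<Sum>(x,K)\<in>p. measure lborel K *\<^sub>R g0 x) - integral {a..b} g) < e"
    by (rule has_integralD[OF g0 \<open>0 < e\<close>]) (rule that)
  define P where "P x d \<longleftrightarrow> (\<forall>u v. u \<le> x \<longrightarrow> x \<le> v \<longrightarrow> {u..v} \<subseteq> {a..b} \<longrightarrow>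
      {u..v} \<subseteq> ball x d \<longrightarrow> (g x - e) * (v - u) \<le> F v - F u)" for x d
  have "\<exists>d>0. x \<in> {a..b} - N \<longrightarrow> P x d" for x
  proof (cases "x \<in> {a..b} - N")
    case True
    then obtain D where D: "D \<ge> g x" "(F has_real_derivative D) (at x within {a..b})"
      using deriv by blast
    obtain d where "0 < d" "P x d"
      by (rule derivative_straddle[OF D(2,1) \<open>0 < e\<close>]) (simp add: P_def that)
    then show ?thesis by blast
  qed (auto intro: exI[of _ 1])
  then obtain \<delta> where \<delta>0: "\<And>x. 0 < \<delta> x" and \<delta>P: "\<And>x. x \<in> {a..b} - N \<Longrightarrow> P x (\<delta> x)"
    by metis
  have \<delta>: "(g x - e) * (v - u) \<le> F v - F u"
    if "x \<in> {a..b} - N" "u \<le> x" "x \<le> v" "{u..v} \<subseteq> {a..b}" "{u..v} \<subseteq> ball x (\<delta> x)" for x u v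
    using \<delta>P[OF that(1)] that unfolding P_def by blast
  define H where "H x = G x \<inter> (if x \<in> N then U else ball x (\<delta> x))" for x
  have "gauge H"
    using \<open>gauge G\<close> U \<delta>0 unfolding gauge_def H_def by auto
  then obtain p where p: "p tagged_division_of {a..b}" and "H fine p"
    using fine_division_exists_real by blast
  then have Gp: "G fine p" and inN: "\<And>x K. (x,K) \<in> p \<Longrightarrow> x \<in> N \<Longrightarrow> K \<subseteq> U"
    and notN: "\<And>x K. (x,K) \<in> p \<Longrightarrow> x \<notin> N \<Longrightarrow> K \<subseteq> ball x (\<delta> x)"
    unfolding fine_def H_def by fastforce+
  define q where "q = {(x,K) \<in> p. x \<in> N}"
  have "q \<subseteq> p" by (auto simp: q_def)
  have "finite p" using p by blast
  have q: "q tagged_partial_division_of {a..b}"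
    using p \<open>q \<subseteq> p\<close> tagged_partial_division_subset unfolding tagged_division_of_def by blast
  have "measure lebesgue (\<Union>(snd ` q)) \<le> measure lebesgue U"
  proof (rule measure_mono_fmeasurable)
    show "\<Union>(snd ` q) \<subseteq> U" using inN by (force simp: q_def)
    show "\<Union>(snd ` q) \<in> sets lebesgue"
      using lmeasurable_division[OF partial_division_of_tagged_division[OF q]] by (rule fmeasurableD)
    show "U \<in> lmeasurable" by (rule Um)
  qed
  with Um d[OF q] have small: "(\<Sum>(x,K)\<in>q. \<bar>F (Sup K) - F (Inf K)\<bar>) < e" by linarith
  have each: "measure lborel K *\<^sub>R g0 x - e * measure lborel K - (if x \<in> N then \<bar>F (Sup K) - F (Inf K)\<bar> else 0)
      \<le> F (Sup K) - F (Inf K)" if xK: "(x,K) \<in> p" for x K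
  proof -
    from p xK obtain u v where K: "K = {u..v}" "x \<in> K" "K \<subseteq> {a..b}"
      using tagged_division_ofD[OF p] by (metis box_real(2))
    then have uv: "u \<le> x" "x \<le> v" by auto
    then have ends: "Sup K = v" "Inf K = u" "measure lborel K = v - u" using K by auto
    show ?thesis
    proof (cases "x \<in> N")
      case True
      have "0 \<le> e * (v - u)" using \<open>0 < e\<close> uv by simp
      then show ?thesis using True unfolding ends by (simp add: g0_def)
    next
      case False
      then have "(g x - e) * (v - u) \<le> F v - F u"
        using \<delta>[of x u v] uv K notN[OF xK] by auto
      then show ?thesis using False unfolding ends by (simp add: g0_def algebra_simps)
    qed
  qed
  have "(\<Sum>(x,K)\<in>p. measure lborel K *\<^sub>R g0 x) - e * (\<Sum>(x,K)\<in>p. measure lborel K)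
      - (\<Sum>(x,K)\<in>p. if x \<in> N then \<bar>F (Sup K) - F (Inf K)\<bar> else 0)
      \<le> (\<Sum>(x,K)\<in>p. F (Sup K) - F (Inf K))"
    unfolding sum_distrib_left sum_subtractf[symmetric]
    using each by (intro sum_mono) (auto simp: case_prod_unfold)
  moreover have "(\<Sum>(x,K)\<in>p. if x \<in> N then \<bar>F (Sup K) - F (Inf K)\<bar> else 0)
      = (\<Sum>(x,K)\<in>q. \<bar>F (Sup K) - F (Inf K)\<bar>)"
    using \<open>finite p\<close> \<open>q \<subseteq> p\<close>
    by (intro sum.mono_neutral_cong_right) (auto simp: q_def split: if_splits)
  moreover have "e * (\<Sum>(x,K)\<in>p. measure lborel K) = e * (b - a)"
    using additive_content_tagged_division[of p a b] p \<open>a \<le> b\<close> by simp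
  moreover have "(\<Sum>(x,K)\<in>p. F (Sup K) - F (Inf K)) = F b - F a"
    using additive_tagged_division_1[OF \<open>a \<le> b\<close> p] .
  moreover have "\<bar>(\<Sum>(x,K)\<in>p. measure lborel K *\<^sub>R g0 x) - integral {a..b} g\<bar> < e"
    using G[of p] p Gp by simp
  moreover have "e * (b - a) + 2 * e = e0"
    using e0 by (simp add: algebra_simps)
  ultimately show "integral {a..b} g \<le> F b - F a + e0"
    using small by linarith
qed


section \<open>Closure properties of absolute continuity\<close>

lemma absolutely_continuous_on_subset:
  assumes "absolutely_continuous_on a b f" "a \<le> c" "d \<le> b"
  shows "absolutely_continuous_on c d f"
proof -
  have "{c..d} \<subseteq> {a..b}" using assms by auto
  then show ?thesis
    using assms(1) unfolding absolutely_continuous_on_def by (meson subset_trans)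
qed

lemma absolutely_continuous_on_imp_continuous_on:
  assumes f: "absolutely_continuous_on a b f"
  shows "continuous_on {a..b} f"
proof (rule continuous_on_iff[THEN iffD2], intro ballI allI impI)
  fix x e :: real assume x: "x \<in> {a..b}" and "0 < e"
  with f obtain d where "0 < d" and
    d: "\<And>D. D division_of \<Union>D \<Longrightarrow> \<Union>D \<subseteq> {a..b} \<Longrightarrow> (\<Sum>K\<in>D. Sup K - Inf K) < d
        \<Longrightarrow> (\<Sum>K\<in>D. \<bar>f (Sup K) - f (Inf K)\<bar>) < e"
    unfolding absolutely_continuous_on_def by meson
  have *: "\<bar>f v - f u\<bar> < e" if "u \<le> v" "{u..v} \<subseteq> {a..b}" "v - u < d" for u v
    using d[of "{{u..v}}"] that division_of_self[of u v] by simp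
  have "dist (f y) (f x) < e" if y: "y \<in> {a..b}" "dist y x < d" for y
  proof (cases "x \<le> y")
    case True
    then show ?thesis using *[of x y] x y by (auto simp: dist_real_def)
  next
    case False
    then show ?thesis using *[of y x] x y by (auto simp: dist_real_def)
  qed
  with \<open>0 < d\<close> show "\<exists>d>0. \<forall>y\<in>{a..b}. dist y x < d \<longrightarrow> dist (f y) (f x) < e" by blast
qed

text \<open>
  The common source of the closure properties below: differences, products and Lipschitz
  images of absolutely continuous functions have increments controlled in this way.
\<close>

lemma absolutely_continuous_on_dominated:
  assumes f: "absolutely_continuous_on a b f" and g: "absolutely_continuous_on a b g"
    and "0 \<le> C"
    and h: "\<And>x y. x \<in> {a..b} \<Longrightarrow> y \<in> {a..b} \<Longrightarrow> \<bar>h y - h x\<bar> \<le> C * (\<bar>f y - f x\<bar> + \<bar>g y - g x\<bar>)"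
  shows "absolutely_continuous_on a b h"
  unfolding absolutely_continuous_on_def
proof (intro allI impI)
  fix e :: real assume "0 < e"
  define e' where "e' = e / (2 * C + 1)"
  have "0 < e'" "2 * C * e' < e" using \<open>0 < e\<close> \<open>0 \<le> C\<close> by (auto simp: e'_def field_simps)
  from f \<open>0 < e'\<close> obtain d1 where "0 < d1" and
    d1: "\<And>D. D division_of \<Union>D \<Longrightarrow> \<Union>D \<subseteq> {a..b} \<Longrightarrow> (\<Sum>K\<in>D. Sup K - Inf K) < d1
        \<Longrightarrow> (\<Sum>K\<in>D. \<bar>f (Sup K) - f (Inf K)\<bar>) < e'"
    unfolding absolutely_continuous_on_def by meson
  from g \<open>0 < e'\<close> obtain d2 where "0 < d2" and
    d2: "\<And>D. D division_of \<Union>D \<Longrightarrow> \<Union>D \<subseteq> {a..b} \<Longrightarrow> (\<Sum>K\<in>D. Sup K - Inf K) < d2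
        \<Longrightarrow> (\<Sum>K\<in>D. \<bar>g (Sup K) - g (Inf K)\<bar>) < e'"
    unfolding absolutely_continuous_on_def by meson
  have "(\<Sum>K\<in>D. \<bar>h (Sup K) - h (Inf K)\<bar>) < e"
    if D: "D division_of \<Union>D" "\<Union>D \<subseteq> {a..b}" and small: "(\<Sum>K\<in>D. Sup K - Inf K) < min d1 d2" for D
  proof -
    have ends: "Inf K \<in> {a..b} \<and> Sup K \<in> {a..b}" if K: "K \<in> D" for K
    proof -
      obtain u v where uv: "K = cbox u v" "K \<noteq> {}"
        using division_ofD(3,4)[OF D(1) K] by auto
      then have "Inf K \<in> K" "Sup K \<in> K" by auto
      then show ?thesis using D(2) K by blast
    qed
    have "(\<Sum>K\<in>D. \<bar>h (Sup K) - h (Inf K)\<bar>)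
        \<le> (\<Sum>K\<in>D. C * (\<bar>f (Sup K) - f (Inf K)\<bar> + \<bar>g (Sup K) - g (Inf K)\<bar>))"
      using h ends by (intro sum_mono) blast
    also have "\<dots> = C * ((\<Sum>K\<in>D. \<bar>f (Sup K) - f (Inf K)\<bar>) + (\<Sum>K\<in>D. \<bar>g (Sup K) - g (Inf K)\<bar>))"
      by (simp only: sum_distrib_left sum.distrib distrib_left)
    also have "\<dots> \<le> C * (e' + e')"
      using d1[OF D] d2[OF D] small \<open>0 \<le> C\<close> by (intro mult_left_mono add_mono) auto
    also have "\<dots> < e" using \<open>2 * C * e' < e\<close> by (simp add: algebra_simps)
    finally show ?thesis .
  qed
  then show "\<exists>\<delta>>0. \<forall>\<D>. \<D> division_of \<Union>\<D> \<and> \<Union>\<D> \<subseteq> {a..b} \<and> (\<Sum>K\<in>\<D>. Sup K - Inf K) < \<delta> \<longrightarrow>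
      (\<Sum>K\<in>\<D>. \<bar>h (Sup K) - h (Inf K)\<bar>) < e"
    using \<open>0 < d1\<close> \<open>0 < d2\<close> by (intro exI[of _ "min d1 d2"]) auto
qed

lemma absolutely_continuous_on_diff:
  assumes "absolutely_continuous_on a b f" "absolutely_continuous_on a b g"
  shows "absolutely_continuous_on a b (\<lambda>x. f x - g x)"
  by (rule absolutely_continuous_on_dominated[OF assms, of 1]) auto

lemma absolutely_continuous_on_mult:
  assumes f: "absolutely_continuous_on a b f" and g: "absolutely_continuous_on a b g"
  shows "absolutely_continuous_on a b (\<lambda>x. f x * g x)"
proof -
  have "bounded (f ` {a..b})" "bounded (g ` {a..b})"
    using f g absolutely_continuous_on_imp_continuous_on compact_continuous_image compact_imp_bounded
    by blast+
  then obtain M N where M: "\<And>x. x \<in> {a..b} \<Longrightarrow> \<bar>f x\<bar> \<le> M" and N: "\<And>x. x \<in> {a..b} \<Longrightarrow> \<bar>g x\<bar> \<le> N"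
    unfolding bounded_iff real_norm_def by (meson imageI)
  let ?C = "max 0 (max M N)"
  show ?thesis
  proof (rule absolutely_continuous_on_dominated[OF f g, of ?C])
    fix x y assume x: "x \<in> {a..b}" and y: "y \<in> {a..b}"
    have "f y * g y - f x * g x = (f y - f x) * g y + f x * (g y - g x)"
      by (simp add: algebra_simps)
    then have "\<bar>f y * g y - f x * g x\<bar> \<le> \<bar>f y - f x\<bar> * \<bar>g y\<bar> + \<bar>f x\<bar> * \<bar>g y - g x\<bar>"
      by (metis abs_mult abs_triangle_ineq)
    also have "\<dots> \<le> \<bar>f y - f x\<bar> * ?C + ?C * \<bar>g y - g x\<bar>"
      using M[OF x] N[OF y] by (intro add_mono mult_left_mono mult_right_mono) auto
    finally show "\<bar>f y * g y - f x * g x\<bar> \<le> ?C * (\<bar>f y - f x\<bar> + \<bar>g y - g x\<bar>)"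
      by (simp add: algebra_simps)
  qed auto
qed

lemma absolutely_continuous_on_compose:
  fixes G :: "real \<Rightarrow> real"
  assumes f: "absolutely_continuous_on a b f" and "0 \<le> C" "convex S" "f ` {a..b} \<subseteq> S"
    and G: "\<And>z. z \<in> S \<Longrightarrow> (G has_real_derivative G' z) (at z within S)"
    and G': "\<And>z. z \<in> S \<Longrightarrow> \<bar>G' z\<bar> \<le> C"
  shows "absolutely_continuous_on a b (\<lambda>x. G (f x))"
proof (rule absolutely_continuous_on_dominated[OF f f \<open>0 \<le> C\<close>])
  fix x y assume "x \<in> {a..b}" "y \<in> {a..b}"
  then have "f x \<in> S" "f y \<in> S" using assms(4) by auto
  then have "\<bar>G (f y) - G (f x)\<bar> \<le> C * \<bar>f y - f x\<bar>"
    using field_differentiable_bound[OF \<open>convex S\<close> G] G' by auto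
  also have "\<dots> \<le> C * (\<bar>f y - f x\<bar> + \<bar>f y - f x\<bar>)"
    using \<open>0 \<le> C\<close> by (intro mult_left_mono) auto
  finally show "\<bar>G (f y) - G (f x)\<bar> \<le> C * (\<bar>f y - f x\<bar> + \<bar>f y - f x\<bar>)" .
qed

lemma continuous_on_interval_pos_lower_bound:
  fixes f :: "real \<Rightarrow> real"
  assumes "continuous_on {a..b} f" "\<And>x. x \<in> {a..b} \<Longrightarrow> 0 < f x"
  obtains m where "0 < m" "f ` {a..b} \<subseteq> {m..}"
proof (cases "{a..b} = {}")
  case True
  then show ?thesis using that[of 1] by auto
next
  case False
  from continuous_attains_inf[OF compact_Icc this assms(1)] obtain x
    where "x \<in> {a..b}" "\<And>y. y \<in> {a..b} \<Longrightarrow> f x \<le> f y" by blast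
  then have "0 < f x" "f ` {a..b} \<subseteq> {f x..}" using assms(2) by auto
  then show ?thesis by (rule that)
qed

lemma absolutely_continuous_on_inverse:
  assumes f: "absolutely_continuous_on a b f" and pos: "\<And>x. x \<in> {a..b} \<Longrightarrow> 0 < f x"
  shows "absolutely_continuous_on a b (\<lambda>x. inverse (f x))"
proof -
  obtain m where m: "0 < m" "f ` {a..b} \<subseteq> {m..}"
    using continuous_on_interval_pos_lower_bound[OF absolutely_continuous_on_imp_continuous_on[OF f] pos] .
  show ?thesis
  proof (rule absolutely_continuous_on_compose[OF f _ _ m(2)])
    fix z assume z: "z \<in> {m..}"
    then show "(inverse has_real_derivative - (inverse z * inverse z)) (at z within {m..})"
      using m(1) by (auto intro!: derivative_eq_intros)
    have "inverse z * inverse z \<le> inverse m * inverse m"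
      using z m(1) by (intro mult_mono) auto
    moreover have "0 < z" using z m(1) by simp
    ultimately show "\<bar>- (inverse z * inverse z)\<bar> \<le> inverse m * inverse m" by (simp add: abs_mult)
  qed auto
qed

lemma absolutely_continuous_on_ln:
  assumes f: "absolutely_continuous_on a b f" and pos: "\<And>x. x \<in> {a..b} \<Longrightarrow> 0 < f x"
  shows "absolutely_continuous_on a b (\<lambda>x. ln (f x))"
proof -
  obtain m where m: "0 < m" "f ` {a..b} \<subseteq> {m..}"
    using continuous_on_interval_pos_lower_bound[OF absolutely_continuous_on_imp_continuous_on[OF f] pos] .
  show ?thesis
  proof (rule absolutely_continuous_on_compose[OF f _ _ m(2)])
    fix z assume z: "z \<in> {m..}"
    then show "(ln has_real_derivative inverse z) (at z within {m..})"
      using m(1) by (auto intro!: derivative_eq_intros simp: field_simps)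
    show "\<bar>inverse z\<bar> \<le> inverse m" using z m(1) by simp
  qed (use m in auto)
qed

text \<open>
  Gronwall's lower estimate. Taking the logarithm turns \<open>W' \<ge> k W\<close> into \<open>(ln W)' \<ge> k\<close>. The other
  usual route, multiplying by the integrating factor \<open>exp (- \<integral> k)\<close>, would need the almost
  everywhere differentiability of an indefinite integral.
\<close>

lemma absolutely_continuous_on_lower_exp_bound:
  fixes W k :: "real \<Rightarrow> real"
  assumes W: "absolutely_continuous_on a b W" and pos: "\<And>x. x \<in> {a..b} \<Longrightarrow> 0 < W x"
    and "a \<le> b" and k: "k integrable_on {a..b}"
    and ae: "AE x in lebesgue. x \<in> {a..b} \<longrightarrow>
      (\<exists>D\<ge>k x * W x. (W has_real_derivative D) (at x within {a..b}))"
  shows "W a * exp (integral {a..b} k) \<le> W b"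
proof -
  have "integral {a..b} k \<le> ln (W b) - ln (W a)"
  proof (rule integral_le_increment[OF absolutely_continuous_on_ln[OF W pos] \<open>a \<le> b\<close> k])
    show "AE x in lebesgue. x \<in> {a..b} \<longrightarrow>
      (\<exists>D\<ge>k x. ((\<lambda>x. ln (W x)) has_real_derivative D) (at x within {a..b}))"
      using ae
    proof (rule AE_mp, intro AE_I2 impI)
      fix x assume x: "x \<in> {a..b}" and
        "x \<in> {a..b} \<longrightarrow> (\<exists>D\<ge>k x * W x. (W has_real_derivative D) (at x within {a..b}))"
      then obtain D where D: "k x * W x \<le> D" "(W has_real_derivative D) (at x within {a..b})"
        by blast
      have "((\<lambda>x. ln (W x)) has_real_derivative D / W x) (at x within {a..b})"
        using pos[OF x] by (auto intro!: derivative_eq_intros D(2))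
      moreover have "k x \<le> D / W x" using D(1) pos[OF x] by (simp add: field_simps)
      ultimately show "\<exists>D\<ge>k x. ((\<lambda>x. ln (W x)) has_real_derivative D) (at x within {a..b})" by blast
    qed
  qed simp
  then have "exp (ln (W a) + integral {a..b} k) \<le> exp (ln (W b))" by simp
  then show ?thesis
    using pos[of a] pos[of b] \<open>a \<le> b\<close> by (simp add: exp_add)
qed

section \<open>Comparison of the two equations\<close>

lemma solution_pair_on_interval:
  assumes sol: "solution_pair p q n \<rho> \<alpha> g \<tau> \<phi> \<psi>" and "\<tau> \<le> a" "a \<le> b"
  shows "absolutely_continuous_on a b \<phi>" "absolutely_continuous_on a b \<psi>"
    and "AE t in lebesgue. t \<in> {a..b} \<longrightarrow>
      (\<phi> has_real_derivative \<psi> t / p t) (at t within {a..b}) \<and>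
      (\<psi> has_real_derivative - (\<Sum>j=1..n. \<rho> j t * \<phi> (\<alpha> j t)) - q t / p t * \<psi> t + g t)
        (at t within {a..b})"
proof -
  show "absolutely_continuous_on a b \<phi>" "absolutely_continuous_on a b \<psi>"
    using assms unfolding solution_pair_def locally_absolutely_continuous_from_def by auto
  have sub: "{a..b} \<subseteq> {\<tau>..}" using \<open>\<tau> \<le> a\<close> by auto
  have "AE t\<in>{\<tau>..} in lebesgue.
        (\<phi> has_real_derivative 1 / p t * \<psi> t) (at t within {\<tau>..}) \<and>
        (\<psi> has_real_derivative
           - (\<Sum>j=1..n. \<rho> j t * \<phi> (\<alpha> j t)) - q t / p t * \<psi> t + g t) (at t within {\<tau>..})"
    using sol unfolding solution_pair_def by blast
  then show "AE t in lebesgue. t \<in> {a..b} \<longrightarrow>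
      (\<phi> has_real_derivative \<psi> t / p t) (at t within {a..b}) \<and>
      (\<psi> has_real_derivative - (\<Sum>j=1..n. \<rho> j t * \<phi> (\<alpha> j t)) - q t / p t * \<psi> t + g t)
        (at t within {a..b})"
    by eventually_elim (use sub in \<open>auto intro: DERIV_subset\<close>)
qed

lemma solution_pair_uminus:
  assumes "solution_pair p q n \<rho> \<alpha> g \<tau> \<phi> \<psi>"
  shows "solution_pair p q n \<rho> \<alpha> (\<lambda>t. - g t) \<tau> (\<lambda>t. - \<phi> t) (\<lambda>t. - \<psi> t)"
proof -
  have neg: "absolutely_continuous_on a b (\<lambda>x. - h x)"
    if "absolutely_continuous_on a b h" for a b h
    by (rule absolutely_continuous_on_dominated[OF that that, of 1]) (auto simp: abs_if)
  have "AE t\<in>{\<tau>..} in lebesgue.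
        (\<phi> has_real_derivative 1 / p t * \<psi> t) (at t within {\<tau>..}) \<and>
        (\<psi> has_real_derivative
           - (\<Sum>j=1..n. \<rho> j t * \<phi> (\<alpha> j t)) - q t / p t * \<psi> t + g t) (at t within {\<tau>..})"
    using assms unfolding solution_pair_def by blast
  then have "AE t\<in>{\<tau>..} in lebesgue.
        ((\<lambda>t. - \<phi> t) has_real_derivative 1 / p t * - \<psi> t) (at t within {\<tau>..}) \<and>
        ((\<lambda>t. - \<psi> t) has_real_derivative
           - (\<Sum>j=1..n. \<rho> j t * - \<phi> (\<alpha> j t)) - q t / p t * - \<psi> t + - g t) (at t within {\<tau>..})"
    by eventually_elim (auto intro!: derivative_eq_intros simp: sum_negf)
  then show ?thesis
    using assms neg unfolding solution_pair_def locally_absolutely_continuous_from_def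
    by (auto intro!: continuous_intros)
qed

text \<open>
  The sign of one summand in the derivative of the Wronskian, where \<open>x = \<phi> t\<close>, \<open>y = \<omega> t\<close>,
  \<open>xa = \<phi> (\<alpha> j t)\<close> and \<open>ya = \<omega> (\<alpha> j t)\<close>. The hypothesis \<open>ratio\<close> says that \<open>\<omega> / \<phi>\<close> is no larger
  at the delayed time. This can be multiplied by \<open>r1\<close> only if \<open>r1 \<ge> 0\<close>; for negative \<open>r1\<close>
  either the left-hand side is negative and the right-hand side is not, or there is no delay and the ratios agree.
\<close>

lemma coefficient_comparison:
  fixes x y xa ya r r1 :: real
  assumes pos: "0 < x" "0 < y" "0 < xa" "0 < ya" and ratio: "ya * x \<le> y * xa"
    and "r1 \<le> r" and neg: "r1 < 0 \<Longrightarrow> 0 \<le> r \<or> xa = x \<and> ya = y"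
  shows "r1 * ya * x \<le> r * xa * y"
proof -
  consider "0 \<le> r1" | "r1 < 0" "0 \<le> r" | "xa = x" "ya = y" using neg by linarith
  then show ?thesis
  proof cases
    case 1
    have "r1 * (ya * x) \<le> r1 * (y * xa)" using 1 ratio by (rule mult_left_mono[rotated])
    also have "\<dots> \<le> r * (y * xa)" using \<open>r1 \<le> r\<close> pos by (intro mult_right_mono) auto
    finally show ?thesis by (simp add: mult_ac)
  next
    case 2
    then have "r1 * (ya * x) \<le> 0" "0 \<le> r * (xa * y)"
      using pos by (auto intro!: mult_nonpos_nonneg)
    then show ?thesis by (simp add: mult_ac)
  next
    case 3
    have "r1 * (x * y) \<le> r * (x * y)" using \<open>r1 \<le> r\<close> pos by (intro mult_right_mono) auto
    then show ?thesis using 3 by (simp add: mult_ac)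
  qed
qed

text \<open>
  The Wronskian argument. Positivity of \<open>W\<close> on \<open>[s, c]\<close> makes \<open>u = \<omega> / \<phi>\<close> increase there, and this in
  turn yields \<open>W c \<ge> K\<close> with a constant \<open>K > 0\<close> that does not depend on \<open>c\<close>. By continuity \<open>W\<close> cannot
  reach 0, so \<open>u \<ge> u s = 1\<close> on the whole interval. The strict inequality between the slopes
  at \<open>s\<close> is what starts the argument.
\<close>

lemma solution_comparison:
  fixes p q f \<phi> \<psi> \<omega> \<Omega> :: "real \<Rightarrow> real" and r r1 \<alpha> :: "nat \<Rightarrow> real \<Rightarrow> real"
  assumes A: "solution_pair p q n r \<alpha> f \<tau> \<phi> \<psi>" and "\<tau> \<le> s"
    and B: "solution_pair p q n r1 \<alpha> (\<lambda>t. 0) s \<omega> \<Omega>"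
    and init: "\<And>t. t \<le> s \<Longrightarrow> \<omega> t = \<phi> t" and "\<psi> s < \<Omega> s"
    and p: "\<And>t. t \<in> {s..e} \<Longrightarrow> 0 < p t"
    and qp: "(\<lambda>t. q t / p t) absolutely_integrable_on {s..e}"
    and f: "\<And>t. t \<in> {s..e} \<Longrightarrow> f t \<le> 0"
    and \<phi>: "\<And>t. t \<in> {s..e} \<Longrightarrow> 0 < \<phi> t"
    and \<phi>\<alpha>: "\<And>j t. j \<in> {1..n} \<Longrightarrow> t \<in> {s..e} \<Longrightarrow> 0 < \<phi> (\<alpha> j t)"
    and \<alpha>: "\<And>j t. j \<in> {1..n} \<Longrightarrow> t \<in> {s..e} \<Longrightarrow> \<alpha> j t \<le> t"
    and r: "\<And>j t. j \<in> {1..n} \<Longrightarrow> t \<in> {s..e} \<Longrightarrow> r1 j t \<le> r j t"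
    and r1: "\<And>j t. j \<in> {1..n} \<Longrightarrow> t \<in> {s..e} \<Longrightarrow> r1 j t < 0 \<Longrightarrow> 0 \<le> r j t \<or> \<alpha> j t = t"
    and t: "t \<in> {s..e}"
  shows "\<phi> t \<le> \<omega> t"
proof -
  define W where "W t = \<phi> t * \<Omega> t - \<omega> t * \<psi> t" for t
  define u where "u t = \<omega> t * inverse (\<phi> t)" for t
  define k where "k t = - (q t / p t)" for t
  define K where "K = W s * exp (- integral {s..e} (\<lambda>t. \<bar>q t / p t\<bar>))"
  have "s \<le> e" using t by simp
  note A' = solution_pair_on_interval[OF A \<open>\<tau> \<le> s\<close>]
  note B' = solution_pair_on_interval[OF B order_refl]
  have "0 < W s"
    using \<open>\<psi> s < \<Omega> s\<close> \<phi>[of s] \<open>s \<le> e\<close> init[of s] by (simp add: W_def)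
  then have "0 < K" by (simp add: K_def)
  have "u s = 1" using \<phi>[of s] \<open>s \<le> e\<close> init[of s] by (simp add: u_def)
  have W_ac: "absolutely_continuous_on x y W" if "s \<le> x" "x \<le> y" for x y
  proof -
    have "absolutely_continuous_on s y W"
      unfolding W_def using A' B' that
      by (intro absolutely_continuous_on_diff absolutely_continuous_on_mult) auto
    then show ?thesis using absolutely_continuous_on_subset that by blast
  qed

  have u_mono: "u x \<le> u y" if W: "\<And>z. z \<in> {s..c} \<Longrightarrow> 0 < W z" and "c \<le> e" and xy: "s \<le> x" "x \<le> y" "y \<le> c"
    for c x y
  proof -
    have sub: "{x..y} \<subseteq> {s..c}" "{x..y} \<subseteq> {s..e}" using xy \<open>c \<le> e\<close> by auto
    have A'': "absolutely_continuous_on x y \<phi>" "absolutely_continuous_on x y \<omega>"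
      using solution_pair_on_interval(1)[OF A] solution_pair_on_interval(1)[OF B] xy \<open>\<tau> \<le> s\<close> by auto
    have "absolutely_continuous_on x y u"
      unfolding u_def using A'' \<phi> sub
      by (intro absolutely_continuous_on_mult absolutely_continuous_on_inverse) auto
    moreover have "AE t in lebesgue. t \<in> {x..y} \<longrightarrow>
        (\<exists>D\<ge>0. (u has_real_derivative D) (at t within {x..y}))"
      using A'(3)[OF \<open>s \<le> e\<close>] B'(3)[OF \<open>s \<le> e\<close>]
    proof eventually_elim
      case (elim t)
      show ?case
      proof
        assume t: "t \<in> {x..y}"
        then have t': "t \<in> {s..e}" "t \<in> {s..c}" using sub by auto
        have "(\<phi> has_real_derivative \<psi> t / p t) (at t within {x..y})"
          "(\<omega> has_real_derivative \<Omega> t / p t) (at t within {x..y})"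
          using elim t' DERIV_subset[OF _ sub(2)] by auto
        then have "(u has_real_derivative W t / (p t * (\<phi> t)\<^sup>2)) (at t within {x..y})"
          unfolding u_def W_def using \<phi>[OF t'(1)] p[OF t'(1)]
          by (auto intro!: derivative_eq_intros simp: field_simps power2_eq_square)
        moreover have "0 \<le> W t / (p t * (\<phi> t)\<^sup>2)"
          using W[OF t'(2)] p[OF t'(1)] by simp
        ultimately show "\<exists>D\<ge>0. (u has_real_derivative D) (at t within {x..y})" by blast
      qed
    qed
    ultimately have "integral {x..y} (\<lambda>t. 0) \<le> u y - u x"
      using \<open>x \<le> y\<close> by (intro integral_le_increment) auto
    then show ?thesis by simp
  qed

  have W_step: "K \<le> W c" if W: "\<And>z. z \<in> {s..c} \<Longrightarrow> 0 < W z" and c: "s \<le> c" "c \<le> e" for c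
  proof -
    have sub: "{s..c} \<subseteq> {s..e}" using c by auto
    \<comment> \<open>A delayed time before \<open>s\<close> falls into the range of the initial function, where \<open>\<omega>\<close> and \<open>\<phi>\<close>
      agree; monotonicity of \<open>u\<close> covers delayed times from \<open>s\<close> on.\<close>
    have delayed: "\<omega> t > 0 \<and> (\<forall>j\<in>{1..n}. \<omega> (\<alpha> j t) > 0 \<and> \<omega> (\<alpha> j t) * \<phi> t \<le> \<omega> t * \<phi> (\<alpha> j t))"
      if t: "t \<in> {s..c}" for t
    proof -
      have u1: "\<phi> z \<le> \<omega> z" if "z \<in> {s..t}" for z
      proof -
        have "1 \<le> u z" using u_mono[OF W \<open>c \<le> e\<close>, of s z] t that \<open>u s = 1\<close> by simp
        then show ?thesis using \<phi>[of z] that t c by (simp add: u_def field_simps)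
      qed
      have "0 < \<omega> (\<alpha> j t) \<and> \<omega> (\<alpha> j t) * \<phi> t \<le> \<omega> t * \<phi> (\<alpha> j t)" if j: "j \<in> {1..n}" for j
      proof (cases "s \<le> \<alpha> j t")
        case True
        have ta: "t \<in> {s..e}" using t c by simp
        have le: "\<alpha> j t \<le> t" using \<alpha>[OF j ta] .
        have "u (\<alpha> j t) \<le> u t" using u_mono[OF W \<open>c \<le> e\<close>, of "\<alpha> j t" t] True le t by simp
        then have "\<omega> (\<alpha> j t) * \<phi> t \<le> \<omega> t * \<phi> (\<alpha> j t)"
          using \<phi>[OF ta] \<phi>\<alpha>[OF j ta] by (simp add: u_def field_simps)
        moreover have "0 < \<omega> (\<alpha> j t)"
          using u1[of "\<alpha> j t"] True le \<phi>\<alpha>[OF j ta] by simp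
        ultimately show ?thesis by simp
      next
        case False
        have ta: "t \<in> {s..e}" using t c by simp
        have "\<omega> (\<alpha> j t) = \<phi> (\<alpha> j t)" using False init by simp
        moreover have "\<phi> t \<le> \<omega> t" using u1[of t] t by simp
        ultimately show ?thesis using \<phi>\<alpha>[OF j ta] by (simp add: mult.commute)
      qed
      moreover have "0 < \<omega> t" using u1[of t] \<phi>[of t] t c by simp
      ultimately show ?thesis by blast
    qed
    have k_int: "k integrable_on {s..e}" and abs_int: "(\<lambda>t. \<bar>q t / p t\<bar>) integrable_on {s..e}"
      using qp unfolding absolutely_integrable_on_def k_def by (auto intro: integrable_neg)
    then have k_int': "k integrable_on {s..c}" and abs_int': "(\<lambda>t. \<bar>q t / p t\<bar>) integrable_on {s..c}"
      using integrable_on_subinterval[OF _ sub] by blast+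
    have "W s * exp (integral {s..c} k) \<le> W c"
    proof (rule absolutely_continuous_on_lower_exp_bound[OF W_ac[OF order_refl \<open>s \<le> c\<close>] W \<open>s \<le> c\<close> k_int'])
      show "AE t in lebesgue. t \<in> {s..c} \<longrightarrow>
          (\<exists>D\<ge>k t * W t. (W has_real_derivative D) (at t within {s..c}))"
        using A'(3)[OF \<open>s \<le> e\<close>] B'(3)[OF \<open>s \<le> e\<close>]
      proof eventually_elim
        case (elim t)
        show ?case
        proof
          assume t: "t \<in> {s..c}"
          then have t': "t \<in> {s..e}" using sub by auto
          let ?a = "\<Sum>j=1..n. r j t * \<phi> (\<alpha> j t)" and ?b = "\<Sum>j=1..n. r1 j t * \<omega> (\<alpha> j t)"
          let ?D = "\<phi> t * (- ?b - q t / p t * \<Omega> t) - \<omega> t * (- ?a - q t / p t * \<psi> t + f t)"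
          have "(\<phi> has_real_derivative \<psi> t / p t) (at t within {s..c})"
            "(\<psi> has_real_derivative - ?a - q t / p t * \<psi> t + f t) (at t within {s..c})"
            "(\<omega> has_real_derivative \<Omega> t / p t) (at t within {s..c})"
            "(\<Omega> has_real_derivative - ?b - q t / p t * \<Omega> t + 0) (at t within {s..c})"
            using elim t' DERIV_subset[OF _ sub] by blast+
          \<comment> \<open>The product rule also produces \<open>\<phi>' \<Omega>\<close> and \<open>\<omega>' \<psi>\<close>, which are both \<open>\<psi> \<Omega> / p\<close> and cancel.\<close>
          from DERIV_diff[OF DERIV_mult[OF this(1,4)] DERIV_mult[OF this(3,2)]]
          have "(W has_real_derivative ?D) (at t within {s..c})"
            unfolding W_def by (simp add: algebra_simps)
          moreover have "k t * W t \<le> ?D"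
          proof -
            have "?b * \<phi> t \<le> ?a * \<omega> t"
              unfolding sum_distrib_right
            proof (rule sum_mono)
              fix j assume j: "j \<in> {1..n}"
              show "r1 j t * \<omega> (\<alpha> j t) * \<phi> t \<le> r j t * \<phi> (\<alpha> j t) * \<omega> t"
                using delayed[OF t] j \<phi>[OF t'] \<phi>\<alpha>[OF j t'] r[OF j t'] r1[OF j t']
                by (intro coefficient_comparison) auto
            qed
            moreover have "\<omega> t * f t \<le> 0"
              using delayed[OF t] f[OF t'] by (simp add: mult_nonneg_nonpos)
            moreover have "?D - k t * W t = ?a * \<omega> t - ?b * \<phi> t - \<omega> t * f t"
              by (simp add: k_def W_def algebra_simps)
            ultimately show ?thesis by linarith
          qed
          ultimately show "\<exists>D\<ge>k t * W t. (W has_real_derivative D) (at t within {s..c})" by blast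
        qed
      qed
    qed
    moreover have "- integral {s..e} (\<lambda>t. \<bar>q t / p t\<bar>) \<le> integral {s..c} k"
    proof -
      have "- integral {s..c} k = integral {s..c} (\<lambda>t. - k t)" by simp
      also have "\<dots> \<le> integral {s..c} (\<lambda>t. \<bar>q t / p t\<bar>)"
      proof (rule integral_le)
        show "(\<lambda>t. - k t) integrable_on {s..c}" using k_int' by (rule integrable_neg)
        show "(\<lambda>t. \<bar>q t / p t\<bar>) integrable_on {s..c}" by (rule abs_int')
        fix t
        show "- k t \<le> \<bar>q t / p t\<bar>" unfolding k_def minus_minus by (rule abs_ge_self)
      qed
      also have "\<dots> \<le> integral {s..e} (\<lambda>t. \<bar>q t / p t\<bar>)"
        using abs_int abs_int' sub by (intro integral_subset_le) auto
      finally show ?thesis by simp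
    qed
    then have "K \<le> W s * exp (integral {s..c} k)"
      using \<open>0 < W s\<close> by (simp add: K_def)
    ultimately show ?thesis by linarith
  qed

  have W_pos: "0 < W z" if "z \<in> {s..e}" for z
  proof (rule ccontr)
    assume "\<not> 0 < W z"
    define S where "S = {z \<in> {s..e}. W z \<le> 0}"
    define c where "c = Inf S"
    have W_cont: "continuous_on {s..e} W"
      using absolutely_continuous_on_imp_continuous_on[OF W_ac] \<open>s \<le> e\<close> by simp
    have "S \<noteq> {}" using \<open>\<not> 0 < W z\<close> \<open>z \<in> {s..e}\<close> by (auto simp: S_def)
    moreover have "closed S"
      unfolding S_def using W_cont by (intro continuous_on_closed_Collect_le closed_atLeastAtMost) auto
    moreover have "bdd_below S" by (auto simp: S_def intro!: bdd_belowI[of _ s])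
    ultimately have "c \<in> S" and first: "\<And>z. z \<in> S \<Longrightarrow> c \<le> z"
      unfolding c_def by (auto intro: closed_contains_Inf cInf_lower)
    then have c: "s \<le> c" "c \<le> e" "W c \<le> 0" by (auto simp: S_def)
    with \<open>0 < W s\<close> have "s < c" by (metis leD order_le_less)
    have before: "0 < W z" if "s \<le> z" "z < c" for z
      using first[of z] that c by (force simp: S_def)
    have cl: "closure {s..<c} = {s..c}" using \<open>s < c\<close> by simp
    have "K \<le> W c"
    proof (rule continuous_ge_on_closure[where f = W])
      show "continuous_on (closure {s..<c}) W"
        unfolding cl using W_cont by (rule continuous_on_subset) (use c in auto)
      show "c \<in> closure {s..<c}" unfolding cl using \<open>s < c\<close> by simp
      show "K \<le> W z" if "z \<in> {s..<c}" for z
        using before that c by (intro W_step) auto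
    qed
    with \<open>0 < K\<close> \<open>W c \<le> 0\<close> show False by simp
  qed
  then have "u s \<le> u t" using u_mono[of e s t] t by simp
  then show ?thesis
    using \<open>u s = 1\<close> \<phi>[OF t] by (simp add: u_def field_simps)
qed

text \<open>
  The comparison solution prolongs \<open>\<phi>\<close> from \<open>(-\<infinity>, s]\<close> with the slope at \<open>s\<close> raised by 1; any
  positive amount would do.
\<close>

lemma not_oscillatory_on_if_positive_solution:
  assumes A: "solution_pair p q n r \<alpha> f \<tau> \<phi> \<psi>" and "t0 \<le> \<tau>" "\<tau> \<le> s"
    and p: "\<And>t. t0 \<le> t \<Longrightarrow> 0 < p t"
    and qp: "locally_integrable_from t0 (\<lambda>t. q t / p t)"
    and solv: "uniquely_solvable t0 p q n r1 \<alpha> (\<lambda>t. 0)"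
    and \<alpha>: "\<And>j t. j \<in> {1..n} \<Longrightarrow> t0 \<le> t \<Longrightarrow> \<alpha> j t \<le> t"
    and r: "\<And>j t. j \<in> {1..n} \<Longrightarrow> t0 \<le> t \<Longrightarrow> r1 j t \<le> r j t"
    and r1: "\<And>j t. j \<in> {1..n} \<Longrightarrow> t0 \<le> t \<Longrightarrow> r1 j t < 0 \<Longrightarrow> 0 \<le> r j t \<or> \<alpha> j t = t"
    and "s \<le> e"
    and f: "\<And>t. t \<in> {s..e} \<Longrightarrow> f t \<le> 0"
    and \<phi>: "\<And>t. t \<in> {s..e} \<Longrightarrow> 0 < \<phi> t"
    and \<phi>\<alpha>: "\<And>j t. j \<in> {1..n} \<Longrightarrow> t \<in> {s..e} \<Longrightarrow> 0 < \<phi> (\<alpha> j t)"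
  shows "\<not> oscillatory_on t0 p q n r1 \<alpha> (\<lambda>t. 0) s e"
proof
  assume osc: "oscillatory_on t0 p q n r1 \<alpha> (\<lambda>t. 0) s e"
  have "t0 \<le> s" using assms by simp
  have "continuous_on {..s} \<phi>"
    using A unfolding solution_pair_def by (auto intro: continuous_on_subset)
  from solv[unfolded uniquely_solvable_def, rule_format, OF \<open>t0 \<le> s\<close> this, of "\<psi> s / p s + 1"]
  have "\<exists>\<omega>. (\<forall>t\<le>s. \<omega> t = \<phi> t) \<and>
      (\<exists>\<Omega>. solution_pair p q n r1 \<alpha> (\<lambda>t. 0) s \<omega> \<Omega> \<and> \<Omega> s = p s * (\<psi> s / p s + 1))"
    by (rule ex1_implies_ex)
  then obtain \<omega> \<Omega> where init: "\<And>t. t \<le> s \<Longrightarrow> \<omega> t = \<phi> t"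
    and B: "solution_pair p q n r1 \<alpha> (\<lambda>t. 0) s \<omega> \<Omega>" and \<Omega>: "\<Omega> s = p s * (\<psi> s / p s + 1)"
    by blast
  have "\<psi> s < \<Omega> s" using p[OF \<open>t0 \<le> s\<close>] by (simp add: \<Omega> field_simps)
  have int: "(\<lambda>t. q t / p t) absolutely_integrable_on {s..e}"
    using qp \<open>t0 \<le> s\<close> \<open>s \<le> e\<close> unfolding locally_integrable_from_def by blast
  have "0 < \<omega> t" if t: "t \<in> {s..e}" for t
  proof -
    have "\<phi> t \<le> \<omega> t"
      by (rule solution_comparison[OF A \<open>\<tau> \<le> s\<close> B init \<open>\<psi> s < \<Omega> s\<close> _ int f \<phi> \<phi>\<alpha> _ _ _ t])
        (use \<open>t0 \<le> s\<close> p \<alpha> r r1 in auto)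
    with \<phi>[OF t] show ?thesis by simp
  qed
  moreover have "\<exists>t\<in>{s..e}. \<omega> t = 0"
    using osc B \<open>t0 \<le> s\<close> unfolding oscillatory_on_def solution_from_def by blast
  ultimately show False by fastforce
qed

section \<open>The oscillation theorem\<close>

lemma continuous_nonzero_constant_sign:
  fixes \<phi> :: "real \<Rightarrow> real"
  assumes "continuous_on UNIV \<phi>" "\<And>t. T < t \<Longrightarrow> \<phi> t \<noteq> 0"
  shows "(\<forall>t>T. 0 < \<phi> t) \<or> (\<forall>t>T. \<phi> t < 0)"
proof (rule ccontr)
  assume "\<not> ?thesis"
  then obtain x y where xy: "T < x" "\<phi> x \<le> 0" "T < y" "0 \<le> \<phi> y" by force
  have "connected (\<phi> ` {T<..})"
    using assms(1) by (intro connected_continuous_image) (auto intro: continuous_on_subset)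
  then have "0 \<in> \<phi> ` {T<..}" using connectedD_interval[of "\<phi> ` {T<..}" "\<phi> x" "\<phi> y" 0] xy by auto
  with assms(2) show False by force
qed

theorem theorem3p2:
  fixes t0 :: real and n :: nat
    and p q f :: "real \<Rightarrow> real"
    and r r1 \<alpha> :: "nat \<Rightarrow> real \<Rightarrow> real"
  assumes "n \<ge> 1"
    and "locally_integrable_from t0 p"
    and "locally_integrable_from t0 q"
    and "locally_integrable_from t0 f"
    and "\<And>j. j \<in> {1..n} \<Longrightarrow> locally_integrable_from t0 (r j)"
    and "\<And>t. t \<ge> t0 \<Longrightarrow> p t > 0"
    and "\<And>j. j \<in> {1..n} \<Longrightarrow> locally_measurable_from t0 (\<alpha> j)"
    and "\<And>j t. j \<in> {1..n} \<Longrightarrow> t \<ge> t0 \<Longrightarrow> \<alpha> j t \<le> t"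
    and "\<And>j. j \<in> {1..n} \<Longrightarrow> continuous_on {t0..} (r1 j)"
    and "locally_integrable_from t0 (\<lambda>t. 1 / p t)"
    and "locally_integrable_from t0 (\<lambda>t. q t / p t)"
    and "uniquely_solvable t0 p q n r \<alpha> f"
    and "uniquely_solvable t0 p q n r1 \<alpha> (\<lambda>t. 0)"
    and I: "\<And>j t. j \<in> {1..n} \<Longrightarrow> t \<ge> t0 \<Longrightarrow> r j t \<ge> r1 j t"
    and II: "\<And>j t. j \<in> {1..n} \<Longrightarrow> t \<ge> t0 \<Longrightarrow> r1 j t < 0 \<Longrightarrow> r j t \<ge> 0 \<or> \<alpha> j t = t"
    and III: "\<And>j. j \<in> {1..n} \<Longrightarrow> filterlim (\<alpha> j) at_top at_top"
    and IV_V: "\<And>T. T \<ge> t0 \<Longrightarrow> \<exists>s1 t1 s2 t2. T < s1 \<and> s1 < t1 \<and> t1 \<le> s2 \<and> s2 < t2 \<and>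
        (\<forall>t\<in>{s1..t1}. f t \<le> 0) \<and> (\<forall>t\<in>{s2..t2}. f t \<ge> 0) \<and>
        oscillatory_on t0 p q n r1 \<alpha> (\<lambda>t. 0) s1 t1 \<and>
        oscillatory_on t0 p q n r1 \<alpha> (\<lambda>t. 0) s2 t2"
  shows "oscillatory t0 p q n r \<alpha> f"
  unfolding oscillatory_def
proof (intro allI impI)
  fix \<tau> \<phi> assume "t0 \<le> \<tau>" and "solution_from p q n r \<alpha> f \<tau> \<phi>"
  then obtain \<psi> where A: "solution_pair p q n r \<alpha> f \<tau> \<phi> \<psi>"
    unfolding solution_from_def by blast
  note not_osc = not_oscillatory_on_if_positive_solution
    [OF _ \<open>t0 \<le> \<tau>\<close> _ assms(6) assms(11) assms(13) assms(8) I II]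
  show "oscillatory_function \<phi>"
  proof (rule ccontr)
    assume "\<not> oscillatory_function \<phi>"
    then obtain T1 where T1: "\<And>t. T1 < t \<Longrightarrow> \<phi> t \<noteq> 0"
      unfolding oscillatory_function_def by blast
    have "eventually (\<lambda>t. \<forall>j\<in>{1..n}. T1 < \<alpha> j t) at_top"
      using III by (intro eventually_ball_finite) (auto simp: filterlim_at_top_dense)
    then obtain T2 where T2: "\<And>t j. T2 \<le> t \<Longrightarrow> j \<in> {1..n} \<Longrightarrow> T1 < \<alpha> j t"
      unfolding eventually_at_top_linorder by blast
    \<comment> \<open>Beyond \<open>\<tau>\<close> the equation holds, beyond \<open>T1\<close> the sign of \<open>\<phi>\<close> is constant, and beyond \<open>T2\<close> this
      also applies to the delayed values.\<close>
    obtain s1 t1 s2 t2 where st: "max \<tau> (max T1 T2) < s1" "s1 < t1" "t1 \<le> s2" "s2 < t2"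
      and f: "\<And>t. t \<in> {s1..t1} \<Longrightarrow> f t \<le> 0" "\<And>t. t \<in> {s2..t2} \<Longrightarrow> - f t \<le> 0"
      and osc: "oscillatory_on t0 p q n r1 \<alpha> (\<lambda>t. 0) s1 t1" "oscillatory_on t0 p q n r1 \<alpha> (\<lambda>t. 0) s2 t2"
      using IV_V[of "max \<tau> (max T1 T2)"] \<open>t0 \<le> \<tau>\<close> by (auto simp: le_max_iff_disj)
    have "continuous_on UNIV \<phi>" using A unfolding solution_pair_def by blast
    from continuous_nonzero_constant_sign[OF this T1]
    show False
    proof
      assume pos: "\<forall>t>T1. 0 < \<phi> t"
      have "\<not> oscillatory_on t0 p q n r1 \<alpha> (\<lambda>t. 0) s1 t1"
        by (rule not_osc[OF A]) (use st f pos T2 in auto)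
      with osc show False by simp
    next
      assume neg: "\<forall>t>T1. \<phi> t < 0"
      have "\<not> oscillatory_on t0 p q n r1 \<alpha> (\<lambda>t. 0) s2 t2"
        by (rule not_osc[OF solution_pair_uminus[OF A]]) (use st f neg T2 in auto)
      with osc show False by simp
    qed
  qed
qed

end
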